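(* Let $X$ be a non-empty separable metric space. Then $$\dim_{tH} X=\min\{d: \exists A\subseteq X \text{ such that } \dim_H A\leq d-1 \text{ and } \dim_t (X\setminus A)\leq 0\},$$ where in particular the minimum on the right-hand side is attained.
   Context: $\dim_H$ denotes Hausdorff dimension, with the convention $\dim_H\emptyset=-1$. $\dim_t$ denotes the (small inductive) topological dimension: $\dim_t\emptyset=-1$ and, for non-empty $X$, inductively $\dim_t X=\inf\{d: X \text{ has a basis } \mathcal U \text{ with } \dim_t\partial U\le d-1 \text{ for every } U\in\mathcal U\}$. The topological Hausdorff dimension is defined by $\dim_{tH}\emptyset=-1$ and, for a non-empty metric space $X$, $\dim_{tH}X=\inf\{d: X \text{ has a basis } \mathcal U \text{ of open sets such that } \dim_H\partial U\le d-1 \text{ for every } U\in\mathcal U\}$. All these can take the value $\infty$; with the convention $\infty-1=\infty$, the value $d=\infty$ always belongs to all sets of $d$ displayed above and in the claim, and $\min\{\infty\}=\infty$. *)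

theory Defs
  imports "HOL-Analysis.Analysis"
begin

definition is_base :: "'a topology \<Rightarrow> 'a set set \<Rightarrow> bool" where
  "is_base X \<B> \<longleftrightarrow>
     (\<forall>U\<in>\<B>. openin X U) \<and> (\<forall>V x. openin X V \<and> x \<in> V \<longrightarrow> (\<exists>U\<in>\<B>. x \<in> U \<and> U \<subseteq> V))"

text \<open>
  All dimensions are extended reals, with \<open>\<infinity> - 1 = \<infinity>\<close>. In \<open>ereal\<close> the infimum
  of the empty set is \<open>\<infinity>\<close>.
\<close>

subsection \<open>Hausdorff dimension\<close>

text \<open>
  The \<open>s\<close>-th power of the diameter, with the conventions \<open>(diam {})^s = 0\<close> for all \<open>s\<close> and
  \<open>(diam U)^0 = 1\<close> for nonempty \<open>U\<close> (whereas \<open>0 powr 0 = 0\<close>).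
\<close>

definition diam_power :: "real \<Rightarrow> 'a::metric_space set \<Rightarrow> ennreal" where
  "diam_power s U = (if U = {} then 0 else if s = 0 then 1 else ennreal (diameter U powr s))"

text \<open>
  Boundedness of the covering sets is required explicitly since \<^const>\<open>diameter\<close> is real-valued
  and carries no information on unbounded sets.
\<close>

definition hausdorff_premeasure :: "real \<Rightarrow> real \<Rightarrow> 'a::metric_space set \<Rightarrow> ennreal" where
  "hausdorff_premeasure s \<delta> A =
     (INF U \<in> {U :: nat \<Rightarrow> 'a set.
                 A \<subseteq> (\<Union>i. U i) \<and> (\<forall>i. bounded (U i) \<and> diameter (U i) \<le> \<delta>)}.
        \<Sum>i. diam_power s (U i))"

text \<open>The supremum is the limit for \<open>\<delta>\<close> tending to \<open>0\<close> from above, by monotonicity in \<open>\<delta>\<close>.\<close>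

definition hausdorff_measure :: "real \<Rightarrow> 'a::metric_space set \<Rightarrow> ennreal" where
  "hausdorff_measure s A = (SUP \<delta> \<in> {0<..}. hausdorff_premeasure s \<delta> A)"

definition hausdorff_dim :: "'a::metric_space set \<Rightarrow> ereal" where
  "hausdorff_dim A =
     (if A = {} then -1 else Inf {ereal s |s. 0 \<le> s \<and> hausdorff_measure s A = 0})"

subsection \<open>Small inductive dimension\<close>

text \<open>
  The library predicate \<^term>\<open>X dim_le n\<close> says that the small inductive dimension of \<open>X\<close> is at
  most the integer \<open>n\<close>. The defining recursion of the dimension is not structural; it is
  recovered below in \<open>small_ind_dim_empty\<close> and \<open>small_ind_dim_nonempty\<close>.
\<close>

definition small_ind_dim :: "'a topology \<Rightarrow> ereal" where
  "small_ind_dim X = Inf {ereal (of_int n) |n. X dim_le n}"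

lemma small_ind_dim_le_real_iff: "small_ind_dim X \<le> ereal r \<longleftrightarrow> X dim_le \<lfloor>r\<rfloor>"
proof
  assume "small_ind_dim X \<le> ereal r"
  also have "ereal r < ereal (of_int (\<lfloor>r\<rfloor> + 1))"
    using floor_correct[of r] by simp
  finally obtain n where n: "X dim_le n" "ereal (of_int n) < ereal (of_int (\<lfloor>r\<rfloor> + 1))"
    unfolding small_ind_dim_def Inf_less_iff by blast
  then have "n \<le> \<lfloor>r\<rfloor>" by simp
  with n(1) show "X dim_le \<lfloor>r\<rfloor>" by (rule dimension_le_mono)
next
  assume "X dim_le \<lfloor>r\<rfloor>"
  then have "small_ind_dim X \<le> ereal (of_int \<lfloor>r\<rfloor>)"
    unfolding small_ind_dim_def by (intro Inf_lower) blast
  also have "\<dots> \<le> ereal r" by simp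
  finally show "small_ind_dim X \<le> ereal r" .
qed

lemma small_ind_dim_ge: "-1 \<le> small_ind_dim X"
  unfolding small_ind_dim_def
proof (rule Inf_greatest)
  fix d assume "d \<in> {ereal (of_int n) |n. X dim_le n}"
  then obtain n where n: "d = ereal (of_int n)" "X dim_le n" by blast
  then have "-1 \<le> (of_int n :: real)" using dimension_le_bound[OF n(2)] by linarith
  then show "-1 \<le> d" unfolding n(1) one_ereal_def by simp
qed

lemma small_ind_dim_empty:
  assumes "topspace X = {}"
  shows "small_ind_dim X = -1"
proof (rule antisym)
  have "X dim_le \<lfloor>of_int (-1) :: real\<rfloor>"
    unfolding floor_of_int dimension_le_eq_empty using assms by simp
  then have "small_ind_dim X \<le> ereal (of_int (-1))" unfolding small_ind_dim_le_real_iff .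
  then show "small_ind_dim X \<le> -1" by (simp add: one_ereal_def)
qed (rule small_ind_dim_ge)

lemma small_ind_dim_nonempty:
  assumes "topspace X \<noteq> {}"
  shows "small_ind_dim X =
     Inf {d. \<exists>\<B>. is_base X \<B> \<and>
                 (\<forall>U\<in>\<B>. small_ind_dim (subtopology X (X frontier_of U)) \<le> d - 1)}"
    (is "_ = Inf ?S")
proof (rule antisym)
  show "Inf ?S \<le> small_ind_dim X"
    unfolding small_ind_dim_def[of X]
  proof (rule Inf_greatest)
    fix d assume "d \<in> {ereal (of_int n) |n. X dim_le n}"
    then obtain n where d: "d = ereal (of_int n)" and n: "X dim_le n" by blast
    let ?B = "{U. openin X U \<and> subtopology X (X frontier_of U) dim_le (n - 1)}"
    have "is_base X ?B"
      unfolding is_base_def using n[unfolded dimension_le.simps[of X n]] by blast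
    moreover have "small_ind_dim (subtopology X (X frontier_of U)) \<le> d - 1" if "U \<in> ?B" for U
      using that small_ind_dim_le_real_iff[of "subtopology X (X frontier_of U)" "of_int (n - 1)"]
      by (simp add: d one_ereal_def)
    ultimately show "Inf ?S \<le> d" by (intro Inf_lower) blast
  qed
next
  show "small_ind_dim X \<le> Inf ?S"
  proof (rule Inf_greatest)
    fix d assume "d \<in> ?S"
    then obtain \<B> where B: "is_base X \<B>"
      and le: "\<And>U. U \<in> \<B> \<Longrightarrow> small_ind_dim (subtopology X (X frontier_of U)) \<le> d - 1" by blast
    obtain x where "x \<in> topspace X" using assms by blast
    then obtain U0 where "U0 \<in> \<B>" using B unfolding is_base_def by blast
    then have "-1 \<le> d - 1" using le small_ind_dim_ge order_trans by blast
    then have d0: "0 \<le> d" by (cases d) (auto simp: one_ereal_def)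
    show "small_ind_dim X \<le> d"
    proof (cases d)
      case (real r)
      have r0: "-1 \<le> \<lfloor>r\<rfloor>" using d0 real by simp linarith
      have "X dim_le \<lfloor>r\<rfloor>"
      proof (rule dimension_le.intros[OF r0])
        fix V a assume "openin X V" "a \<in> V"
        then obtain U where U: "U \<in> \<B>" "a \<in> U" "U \<subseteq> V" "openin X U"
          using B unfolding is_base_def by metis
        have "small_ind_dim (subtopology X (X frontier_of U)) \<le> ereal (r - 1)"
          using le[OF U(1)] real by (simp add: one_ereal_def)
        then have "subtopology X (X frontier_of U) dim_le (\<lfloor>r\<rfloor> - 1)"
          unfolding small_ind_dim_le_real_iff by simp
        with U show "\<exists>U. a \<in> U \<and> U \<subseteq> V \<and> openin X U \<and>
            subtopology X (X frontier_of U) dim_le (\<lfloor>r\<rfloor> - 1)" by blast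
      qed
      then show ?thesis unfolding real small_ind_dim_le_real_iff .
    qed (use d0 in auto)
  qed
qed

subsection \<open>Topological Hausdorff dimension\<close>

text \<open>A metric space is given by a subset \<open>X\<close> of a metric type, with the induced metric;
  boundaries are taken in \<open>X\<close>.\<close>

definition top_hausdorff_dim :: "'a::metric_space set \<Rightarrow> ereal" where
  "top_hausdorff_dim X =
     (if X = {} then -1
      else Inf {d. \<exists>\<B>. is_base (top_of_set X) \<B> \<and>
                       (\<forall>U\<in>\<B>. hausdorff_dim (top_of_set X frontier_of U) \<le> d - 1)})"

end

theory Submission
  imports Defs
begin

text \<open>
  If \<open>X - A\<close> is zero-dimensional, then every point of \<open>X\<close> has arbitrarily small open neighbourhoods
  whose boundary misses \<open>X - A\<close>, hence lies in \<open>A\<close>. Conversely, a base of a second countable space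
  contains a countable base, and removing the boundaries of its members leaves a zero-dimensional
  space, while countable stability controls the Hausdorff dimension of the removed set. This gives,
  for each \<open>d > dim\<^sub>t\<^sub>H X\<close>, a set \<open>A\<close> as required. For the value \<open>d = dim\<^sub>t\<^sub>H X\<close> itself, take such sets
  \<open>A n\<close> for \<open>d + 1/n\<close>, enlarge them to \<open>G\<^sub>\<delta>\<close> sets of the same Hausdorff dimension and intersect them:
  the complement is a countable union of zero-dimensional \<open>F\<^sub>\<sigma>\<close> sets, to which the countable sum
  theorem applies.
\<close>

subsection \<open>Hausdorff measure and dimension\<close>

lemma suminf_ennreal_geometric:
  assumes "0 \<le> e"
  shows "(\<Sum>i. ennreal (e * (1/2) ^ Suc i)) = ennreal e"
proof -
  have "(\<lambda>i. e * (1/2) ^ Suc i) sums (e * 1)" by (intro sums_mult power_half_series)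
  then show ?thesis using assms by (intro suminf_ennreal_eq) auto
qed

lemma hausdorff_measure_eq_0I:
  assumes "\<And>\<delta>. 0 < \<delta> \<Longrightarrow> hausdorff_premeasure s \<delta> A \<le> 0"
  shows "hausdorff_measure s A = 0"
proof -
  have "hausdorff_measure s A \<le> 0"
    unfolding hausdorff_measure_def by (rule SUP_least) (use assms in auto)
  then show ?thesis by simp
qed

text \<open>Open balls of positive radius make every cover an open set, which the
  \<open>G\<^sub>\<delta>\<close> hull below relies on. No mesh size occurs: for positive
  \<open>s\<close>, a small total already forces every radius to be small.\<close>

definition ball_cover :: "real \<Rightarrow> real \<Rightarrow> 'a::metric_space set \<Rightarrow> (nat \<Rightarrow> 'a) \<Rightarrow> (nat \<Rightarrow> real) \<Rightarrow> bool" where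
  "ball_cover s e A c r \<longleftrightarrow>
     (\<forall>i. 0 < r i) \<and> A \<subseteq> (\<Union>i. ball (c i) (r i)) \<and> (\<Sum>i. ennreal (r i powr s)) < ennreal e"

lemma ball_coverD:
  assumes "ball_cover s e A c r"
  shows "0 < r i" "A \<subseteq> (\<Union>i. ball (c i) (r i))" "(\<Sum>i. ennreal (r i powr s)) < ennreal e"
  using assms unfolding ball_cover_def by auto

text \<open>A bounded set lies in a ball about any of its points with radius exceeding its diameter,
  and a ball of radius \<open>r\<close> has diameter at most \<open>2 * r\<close>, so changing
  between arbitrary sets and balls costs only constant factors. For \<open>s = 0\<close> the
  criterion fails already for the empty set, since every term of the sum would be 1.\<close>

lemma hausdorff_measure_eq_0_iff:
  fixes A :: "'a::metric_space set"
  assumes s: "0 < s"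
  shows "hausdorff_measure s A = 0 \<longleftrightarrow>
    (\<forall>e>0. \<exists>c r. ball_cover s e A c r)"
proof (intro iffI allI impI)
  fix e :: real
  assume null: "hausdorff_measure s A = 0" and e: "0 < e"
  \<comment> \<open>The sets and the padding of the radii contribute at most \<open>\<eta>\<close>
    each, and doubling the radii multiplies by \<open>2 powr s\<close>; the total
    \<open>2 * e / 3\<close> stays strictly below \<open>e\<close>.\<close>
  define \<eta> where "\<eta> = e / (3 * 2 powr s)"
  have \<eta>: "0 < \<eta>" using e by (simp add: \<eta>_def)
  have "hausdorff_premeasure s 1 A \<le> hausdorff_measure s A"
    unfolding hausdorff_measure_def by (rule SUP_upper) simp
  then have "hausdorff_premeasure s 1 A < ennreal \<eta>" using null \<eta> by simp
  then obtain U :: "nat \<Rightarrow> 'a set" where U: "A \<subseteq> (\<Union>i. U i)" "\<And>i. bounded (U i)"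
      "(\<Sum>i. diam_power s (U i)) < ennreal \<eta>"
    unfolding hausdorff_premeasure_def INF_less_iff by blast
  \<comment> \<open>The padding keeps radii positive even when \<open>U i\<close> is empty or a
    single point; its \<open>s\<close>-th powers sum to \<open>\<eta>\<close>.\<close>
  define \<delta> where "\<delta> i = (\<eta> * (1/2) ^ Suc i) powr (1 / s)" for i
  have \<delta>: "0 < \<delta> i" "\<delta> i powr s = \<eta> * (1/2) ^ Suc i" for i
    using s \<eta> by (simp_all add: \<delta>_def powr_powr)
  define c where "c i = (SOME x. x \<in> U i)" for i
  define d where "d i = (if U i = {} then 0 else diameter (U i))" for i
  \<comment> \<open>The factor 2 puts the radius strictly above the diameter, as an open ball
    requires.\<close>
  define r where "r i = 2 * max (d i) (\<delta> i)" for i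
  have d0: "0 \<le> d i" for i using U(2) by (simp add: d_def diameter_ge_0)
  have dU: "diam_power s (U i) = ennreal (d i powr s)" for i
    using s by (simp add: diam_power_def d_def)
  have r0: "0 < r i" for i using \<delta>(1)[of i] by (simp add: r_def less_max_iff_disj)
  have "U i \<subseteq> ball (c i) (r i)" for i
  proof
    fix x assume x: "x \<in> U i"
    then have "c i \<in> U i" unfolding c_def by (rule someI)
    then have "dist (c i) x \<le> d i"
      using x diameter_bounded_bound[OF U(2)] by (auto simp: d_def)
    also have "\<dots> < r i" using \<delta>(1)[of i] d0[of i] by (auto simp: r_def max_def)
    finally show "x \<in> ball (c i) (r i)" by simp
  qed
  then have cover: "A \<subseteq> (\<Union>i. ball (c i) (r i))" using U(1) by fastforce
  have "r i powr s \<le> 2 powr s * (d i powr s + \<eta> * (1/2) ^ Suc i)" for i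
  proof -
    have "r i powr s = 2 powr s * max (d i) (\<delta> i) powr s"
      using d0[of i] by (simp add: r_def powr_mult)
    also have "max (d i) (\<delta> i) powr s \<le> d i powr s + \<delta> i powr s" by (simp add: max_def)
    finally show ?thesis by (simp add: \<delta>(2))
  qed
  then have "(\<Sum>i. ennreal (r i powr s)) \<le>
      (\<Sum>i. ennreal (2 powr s) * (ennreal (d i powr s) + ennreal (\<eta> * (1/2) ^ Suc i)))"
    using \<eta> by (intro suminf_le summableI)
      (simp flip: ennreal_plus ennreal_mult add: ennreal_leI)
  also have "\<dots> = ennreal (2 powr s) * ((\<Sum>i. diam_power s (U i)) + ennreal \<eta>)"
    using \<eta> by (simp only: ennreal_suminf_cmult dU suminf_add[OF summableI summableI, symmetric]
        suminf_ennreal_geometric less_imp_le)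
  also have "\<dots> \<le> ennreal (2 powr s) * (ennreal \<eta> + ennreal \<eta>)"
    using U(3) by (intro mult_left_mono add_right_mono) auto
  also have "\<dots> = ennreal (2 powr s * (\<eta> + \<eta>))"
    using \<eta> by (simp flip: ennreal_plus ennreal_mult)
  also have "2 powr s * (\<eta> + \<eta>) < e" using e by (simp add: \<eta>_def field_simps)
  then have "ennreal (2 powr s * (\<eta> + \<eta>)) < ennreal e" using e by (simp add: ennreal_lessI)
  finally have "ball_cover s e A c r" using r0 cover by (simp add: ball_cover_def)
  then show "\<exists>c r. ball_cover s e A c r" by blast
next
  assume covers: "\<forall>e>0. \<exists>c r. ball_cover s e A c r"
  have small: "hausdorff_premeasure s \<delta> A \<le> ennreal e" if \<delta>: "0 < \<delta>" and e: "0 < e" for \<delta> e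
  proof -
    \<comment> \<open>The first entry absorbs the factor \<open>2 powr s\<close> lost in passing
      from radii to diameters. The second forces each radius below \<open>\<delta> / 2\<close>,
      because a single term is bounded by the whole sum.\<close>
    define e' where "e' = min (e / 2 powr s) ((\<delta> / 2) powr s)"
    have "0 < e'" using \<delta> e by (simp add: e'_def)
    then obtain c r where "ball_cover s e' A c r"
      using covers by blast
    note cr = ball_coverD[OF this]
    have diam: "diameter (ball (c i) (r i)) \<le> 2 * r i" for i
    proof -
      have "dist x y \<le> 2 * r i" if "x \<in> ball (c i) (r i)" "y \<in> ball (c i) (r i)" for x y
        using that dist_triangle2[of x y "c i"] by (simp add: dist_commute)
      then show ?thesis
        using cr(1)[of i] by (auto simp: diameter_def intro!: cSUP_least)
    qed
    have "2 * r i \<le> \<delta>" for i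
    proof -
      have "ennreal (r i powr s) < ennreal e'" using cr(3) by (rule ennreal_suminf_lessD)
      then have "r i powr s < (\<delta> / 2) powr s"
        by (simp add: ennreal_less_iff e'_def)
      moreover have "(\<delta> / 2) powr s \<le> r i powr s" if "\<delta> / 2 \<le> r i"
        using that s \<delta> by (intro powr_mono2) auto
      ultimately show ?thesis by linarith
    qed
    with diam have "diameter (ball (c i) (r i)) \<le> \<delta>" for i by (meson order_trans)
    then have "hausdorff_premeasure s \<delta> A \<le> (\<Sum>i. diam_power s (ball (c i) (r i)))"
      unfolding hausdorff_premeasure_def using cr(2) by (intro INF_lower) simp
    also have "\<dots> \<le> (\<Sum>i. ennreal (2 powr s) * ennreal (r i powr s))"
    proof (intro suminf_le summableI)
      fix i
      have "diameter (ball (c i) (r i)) powr s \<le> (2 * r i) powr s"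
        using diam s by (intro powr_mono2) (auto simp: diameter_ge_0)
      then show "diam_power s (ball (c i) (r i)) \<le> ennreal (2 powr s) * ennreal (r i powr s)"
        using s cr(1)[of i] by (simp add: diam_power_def powr_mult ennreal_leI flip: ennreal_mult)
    qed
    also have "\<dots> = ennreal (2 powr s) * (\<Sum>i. ennreal (r i powr s))" by simp
    also have "\<dots> \<le> ennreal (2 powr s) * ennreal e'"
      using cr(3) by (intro mult_left_mono) auto
    also have "\<dots> = ennreal (2 powr s * e')" using \<open>0 < e'\<close> by (simp flip: ennreal_mult)
    also have "\<dots> \<le> ennreal e"
    proof (rule ennreal_leI)
      have "2 powr s * e' \<le> 2 powr s * (e / 2 powr s)" by (intro mult_left_mono) (auto simp: e'_def)
      then show "2 powr s * e' \<le> e" by simp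
    qed
    finally show ?thesis .
  qed
  have "hausdorff_premeasure s \<delta> A \<le> 0" if "0 < \<delta>" for \<delta>
  proof (rule ennreal_le_epsilon)
    fix e :: real assume "0 < e"
    then show "hausdorff_premeasure s \<delta> A \<le> 0 + ennreal e" using small[OF that] by simp
  qed
  then show "hausdorff_measure s A = 0" by (rule hausdorff_measure_eq_0I)
qed

lemma hausdorff_measure_mono:
  assumes "A \<subseteq> B"
  shows "hausdorff_measure s A \<le> hausdorff_measure s B"
  unfolding hausdorff_measure_def hausdorff_premeasure_def
  by (intro SUP_mono' INF_superset_mono) (use assms in auto)

lemma hausdorff_measure_empty [simp]: "hausdorff_measure s {} = 0"
proof (rule hausdorff_measure_eq_0I)
  fix \<delta> :: real assume "0 < \<delta>"
  then have "hausdorff_premeasure s \<delta> ({} :: 'a set) \<le> (\<Sum>i. diam_power s ({} :: 'a set))"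
    unfolding hausdorff_premeasure_def by (intro INF_lower) simp
  then show "hausdorff_premeasure s \<delta> ({} :: 'a set) \<le> 0" by (simp add: diam_power_def)
qed

text \<open>In exponent 0 each nonempty covering set weighs 1, so covering a nonempty set costs at
  least 1.\<close>

lemma hausdorff_measure_0_eq_0_imp_empty:
  assumes "hausdorff_measure 0 A = 0"
  shows "A = {}"
proof (rule ccontr)
  assume A: "A \<noteq> {}"
  have "1 \<le> hausdorff_premeasure 0 1 A"
    unfolding hausdorff_premeasure_def
  proof (rule INF_greatest)
    fix U :: "nat \<Rightarrow> 'a set"
    assume "U \<in> {U. A \<subseteq> \<Union> (range U) \<and> (\<forall>i. bounded (U i) \<and> diameter (U i) \<le> 1)}"
    then have "(\<Union>i. U i) \<noteq> {}" using A by auto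
    then obtain i where "U i \<noteq> {}" by blast
    then have "1 = (\<Sum>j\<in>{i}. diam_power 0 (U j))" by (simp add: diam_power_def)
    also have "\<dots> \<le> (\<Sum>j. diam_power 0 (U j))" by (rule sum_le_suminf) auto
    finally show "1 \<le> (\<Sum>j. diam_power 0 (U j))" .
  qed
  also have "\<dots> \<le> hausdorff_measure 0 A"
    unfolding hausdorff_measure_def by (rule SUP_upper) simp
  finally show False using assms by simp
qed

text \<open>In a ball cover of total below 1 all radii are at most 1, and for such radii a larger
  exponent gives a smaller power. Exponent 0 lies outside the ball criterion but concerns only the
  empty set.\<close>

lemma hausdorff_measure_eq_0_mono:
  assumes null: "hausdorff_measure s A = 0" and st: "0 \<le> s" "s \<le> t"
  shows "hausdorff_measure t A = 0"
proof (cases "s = t")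
  case False
  show ?thesis
  proof (cases "s = 0")
    case True
    then have "A = {}" using null hausdorff_measure_0_eq_0_imp_empty by blast
    then show ?thesis by simp
  next
    case s0: False
    then have s: "0 < s" "0 < t" using st by auto
    show ?thesis
      unfolding hausdorff_measure_eq_0_iff[OF s(2)]
    proof (intro allI impI)
      fix e :: real assume "0 < e"
      then obtain c r where "ball_cover s (min 1 e) A c r"
        using null unfolding hausdorff_measure_eq_0_iff[OF s(1)]
        by (metis min_less_iff_conj zero_less_one)
      note cr = ball_coverD[OF this]
      have "(\<Sum>i. ennreal (r i powr t)) \<le> (\<Sum>i. ennreal (r i powr s))"
      proof (intro suminf_le summableI ennreal_leI)
        fix i
        have "ennreal (r i powr s) < ennreal (min 1 e)" using cr(3) by (rule ennreal_suminf_lessD)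
        then have "r i powr s < 1 powr s" by (simp add: ennreal_less_iff)
        then have "r i \<le> 1" using s(1) cr(1)[of i] by (smt (verit) powr_mono2)
        then show "r i powr t \<le> r i powr s" using cr(1)[of i] st by (intro powr_mono') auto
      qed
      also have "\<dots> < ennreal (min 1 e)" by fact
      also have "\<dots> \<le> ennreal e" by (intro ennreal_leI) simp
      finally have "ball_cover t e A c r" using cr by (simp add: ball_cover_def)
      then show "\<exists>c r. ball_cover t e A c r" by blast
    qed
  qed
qed (use null in simp)

text \<open>The covers of the sets \<open>A n\<close> receive budgets summing to
  \<open>e / 2\<close> and are merged into one sequence by the pairing function. Halving
  \<open>e\<close> keeps the final bound strict, since summing the budgets gives only a weak
  inequality.\<close>

lemma hausdorff_measure_UN_eq_0:
  fixes A :: "nat \<Rightarrow> 'a::metric_space set"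
  assumes s: "0 < s" and null: "\<And>n. hausdorff_measure s (A n) = 0"
  shows "hausdorff_measure s (\<Union>n. A n) = 0"
  unfolding hausdorff_measure_eq_0_iff[OF s]
proof (intro allI impI)
  fix e :: real assume e: "0 < e"
  have "\<exists>c r. ball_cover s (e / 2 * (1/2) ^ Suc n) (A n) c r" for n
    using null[of n] e unfolding hausdorff_measure_eq_0_iff[OF s] by simp
  then obtain c r where "\<And>n. ball_cover s (e / 2 * (1/2) ^ Suc n) (A n) (c n) (r n)"
    by metis
  note cr = ball_coverD[OF this]
  define c' where "c' k = case_prod c (prod_decode k)" for k
  define r' where "r' k = case_prod r (prod_decode k)" for k
  have "(\<Union>n. A n) \<subseteq> (\<Union>k. ball (c' k) (r' k))"
  proof
    fix x assume "x \<in> (\<Union>n. A n)"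
    then obtain n where "x \<in> A n" by blast
    then have "x \<in> (\<Union>i. ball (c n i) (r n i))" using cr(2)[of n] by (rule subsetD[rotated])
    then obtain i where "x \<in> ball (c n i) (r n i)" by blast
    then have "x \<in> ball (c' (prod_encode (n,i))) (r' (prod_encode (n,i)))"
      by (simp add: c'_def r'_def)
    then show "x \<in> (\<Union>k. ball (c' k) (r' k))" by blast
  qed
  moreover have "0 < r' k" for k using cr(1) by (simp add: r'_def split: prod.split)
  moreover have "(\<Sum>k. ennreal (r' k powr s)) < ennreal e"
  proof -
    have "(\<Sum>k. ennreal (r' k powr s)) = (\<Sum>n. \<Sum>i. ennreal (r n i powr s))"
    proof -
      let ?f = "\<lambda>(n,i). ennreal (r n i powr s)"
      have "ennreal (r' k powr s) = ?f (prod_decode k)" for k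
        by (simp add: r'_def split: prod.split)
      then have "(\<Sum>k. ennreal (r' k powr s)) = (\<Sum>k. ?f (prod_decode k))" by simp
      also have "\<dots> = (\<Sum>n. \<Sum>i. ennreal (r n i powr s))"
        by (rule suminf_ennreal_2dimen) simp
      finally show ?thesis .
    qed
    also have "\<dots> \<le> (\<Sum>n. ennreal (e / 2 * (1/2) ^ Suc n))"
      using cr(3) by (intro suminf_le summableI) (simp add: less_imp_le)
    also have "\<dots> = ennreal (e / 2)" using e by (intro suminf_ennreal_geometric) simp
    also have "\<dots> < ennreal e" using e by (simp add: ennreal_lessI)
    finally show ?thesis .
  qed
  ultimately have "ball_cover s e (\<Union>n. A n) c' r'" by (simp add: ball_cover_def)
  then show "\<exists>c r. ball_cover s e (\<Union>n. A n) c r" by blast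
qed

section \<open>Hausdorff dimension: countable stability and \<open>G\<^sub>\<delta>\<close>
  hulls\<close>

lemma hausdorff_dim_nonneg: "A \<noteq> {} \<Longrightarrow> 0 \<le> hausdorff_dim A"
  unfolding hausdorff_dim_def by (auto intro!: Inf_greatest)

lemma hausdorff_dim_ge: "-1 \<le> hausdorff_dim A"
proof (cases "A = {}")
  case False
  have "(-1::ereal) \<le> 0" by simp
  also have "0 \<le> hausdorff_dim A" using False by (rule hausdorff_dim_nonneg)
  finally show ?thesis .
qed (simp add: hausdorff_dim_def)

lemma hausdorff_dim_empty [simp]: "hausdorff_dim {} = -1"
  by (simp add: hausdorff_dim_def)

text \<open>The infimum need not be attained, so the measure is tested only at exponents strictly
  above \<open>d\<close>. These are positive, so the ball criterion applies to them.\<close>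

lemma hausdorff_dim_le_ereal_iff:
  assumes "A \<noteq> {}"
  shows "hausdorff_dim A \<le> ereal d \<longleftrightarrow> 0 \<le> d \<and> (\<forall>s>d. hausdorff_measure s A = 0)"
proof
  assume le: "hausdorff_dim A \<le> ereal d"
  have "0 \<le> ereal d" using hausdorff_dim_nonneg[OF assms] le by (rule order_trans)
  moreover have "hausdorff_measure s A = 0" if "d < s" for s
  proof -
    have "hausdorff_dim A < ereal s" using le that by (simp add: le_less_trans)
    then obtain t where "0 \<le> t" "hausdorff_measure t A = 0" "t < s"
      using assms unfolding hausdorff_dim_def by (auto simp: Inf_less_iff)
    then show ?thesis by (auto intro: hausdorff_measure_eq_0_mono)
  qed
  ultimately show "0 \<le> d \<and> (\<forall>s>d. hausdorff_measure s A = 0)" by simp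
next
  assume d: "0 \<le> d \<and> (\<forall>s>d. hausdorff_measure s A = 0)"
  show "hausdorff_dim A \<le> ereal d"
  proof (rule ereal_le_epsilon2)
    fix e :: real assume "0 < e"
    then have "hausdorff_measure (d + e) A = 0" "0 \<le> d + e" using d by auto
    then show "hausdorff_dim A \<le> ereal d + ereal e"
      using assms unfolding hausdorff_dim_def by (auto intro!: Inf_lower)
  qed
qed

lemma hausdorff_dim_mono:
  assumes "A \<subseteq> B"
  shows "hausdorff_dim A \<le> hausdorff_dim B"
proof (cases "A = {}")
  case True
  then show ?thesis using hausdorff_dim_ge by simp
next
  case False
  have "hausdorff_measure s A = 0" if "hausdorff_measure s B = 0" for s
    using hausdorff_measure_mono[OF assms, of s] that by simp
  then show ?thesis
    using False assms unfolding hausdorff_dim_def by (auto intro!: Inf_superset_mono)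
qed

lemma hausdorff_dim_UN_le:
  assumes I: "countable I" and d: "-1 \<le> d" and le: "\<And>i. i \<in> I \<Longrightarrow> hausdorff_dim (A i) \<le> d"
  shows "hausdorff_dim (\<Union>i\<in>I. A i) \<le> d"
proof (cases "(\<Union>i\<in>I. A i) = {}")
  case True
  show ?thesis unfolding True using d by simp
next
  case ne: False
  show ?thesis
  proof (cases d)
    case (real x)
    obtain i where i: "i \<in> I" "A i \<noteq> {}" using ne by blast
    then have x: "0 \<le> x" using le[OF i(1)] hausdorff_dim_le_ereal_iff[OF i(2)] real by simp
    have "hausdorff_measure s (\<Union>i\<in>I. A i) = 0" if s: "x < s" for s
    proof -
      have "hausdorff_measure s (A j) = 0" if "j \<in> I" for j
      \<comment> \<open>The characterisation above is for nonempty sets; an empty \<open>A j\<close>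
        is handled as a subset of the nonempty \<open>A i\<close>.\<close>
      proof (cases "A j = {}")
        case True
        have "hausdorff_measure s (A i) = 0"
          using le[OF i(1)] real s by (simp add: hausdorff_dim_le_ereal_iff[OF i(2)])
        then show ?thesis using hausdorff_measure_mono[of "A j" "A i" s] True by simp
      next
        case False
        then show ?thesis using le[OF that] real s by (simp add: hausdorff_dim_le_ereal_iff)
      qed
      moreover have "from_nat_into I n \<in> I" for n using i(1) by (auto intro: from_nat_into)
      ultimately have "hausdorff_measure s (\<Union>n. A (from_nat_into I n)) = 0"
        using x s by (intro hausdorff_measure_UN_eq_0) auto
      moreover have "range (from_nat_into I) = I" using I i(1) by (intro range_from_nat_into) auto
      then have "(\<Union>n. A (from_nat_into I n)) = (\<Union>i\<in>I. A i)"
        by (metis image_image)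
      ultimately show ?thesis by simp
    qed
    then show ?thesis unfolding real hausdorff_dim_le_ereal_iff[OF ne] using x by blast
  qed (use d in auto)
qed

text \<open>For exponents \<open>s n\<close> decreasing to the dimension and costs
  \<open>1 / real (Suc m)\<close>, take the union of a ball cover of \<open>A\<close>. The
  intersection of these countably many open sets is contained in each of the covers, so it is null
  for every \<open>s n\<close>. In infinite dimension the whole space serves by
  monotonicity.\<close>

lemma hausdorff_dim_gdelta_hull:
  fixes A :: "'a::metric_space set"
  obtains G where "gdelta_in euclidean G" "A \<subseteq> G" "hausdorff_dim G = hausdorff_dim A"
proof (cases "A = {}")
  case True
  then show thesis using that[of "{}"] by simp
next
  case ne: False
  show thesis
  proof (cases "hausdorff_dim A")
    case PInf
    have "hausdorff_dim (UNIV :: 'a set) = \<infinity>"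
      using hausdorff_dim_mono[of A UNIV] PInf by simp
    then show thesis using that[of UNIV] PInf gdelta_in_topspace[of euclidean] by simp
  next
    case (real d)
    have d: "0 \<le> d" "\<And>s. d < s \<Longrightarrow> hausdorff_measure s A = 0"
      using hausdorff_dim_le_ereal_iff[OF ne, of d] real by auto
    define s where "s n = d + 1 / real (Suc n)" for n
    have s: "0 < s n" "d < s n" for n using d(1) by (simp_all add: s_def add_nonneg_pos)
    have "\<exists>c r. ball_cover (s n) (1 / real (Suc m)) A c r" for n m
      using d(2)[OF s(2)[of n]] unfolding hausdorff_measure_eq_0_iff[OF s(1)] by simp
    then obtain c r where "\<And>n m. ball_cover (s n) (1 / real (Suc m)) A (c n m) (r n m)"
      by metis
    note cr = ball_coverD[OF this]
    define O' where "O' n m = (\<Union>i. ball (c n m i) (r n m i))" for n m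
    define G where "G = (\<Inter>n. \<Inter>m. O' n m)"
    have AG: "A \<subseteq> G" unfolding G_def O'_def using cr(2) by blast
    have "gdelta_in euclidean (O' n m)" for n m
      by (rule open_imp_gdelta_in) (auto simp: O'_def)
    then have gd: "gdelta_in euclidean G"
      unfolding G_def
      by (intro gdelta_in_Inter countable_image) (auto intro!: gdelta_in_Inter)
    have null: "hausdorff_measure (s n) G = 0" for n
      unfolding hausdorff_measure_eq_0_iff[OF s(1)]
    proof (intro allI impI)
      fix e :: real assume "0 < e"
      then obtain m where m: "1 / real (Suc m) < e" by (meson nat_approx_posE)
      have "G \<subseteq> (\<Union>i. ball (c n m i) (r n m i))" unfolding G_def O'_def by blast
      moreover have "(\<Sum>i. ennreal (r n m i powr s n)) < ennreal e"
        using cr(3)[of n m] m by (meson ennreal_leI less_imp_le less_le_trans)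
      ultimately have "ball_cover (s n) e G (c n m) (r n m)" using cr(1) by (simp add: ball_cover_def)
      then show "\<exists>c r. ball_cover (s n) e G c r" by blast
    qed
    have "hausdorff_measure t G = 0" if "d < t" for t
    proof -
      have "0 < t - d" using that by simp
      then obtain n where "1 / real (Suc n) < t - d" by (meson nat_approx_posE)
      then have "s n \<le> t" by (simp add: s_def)
      then show ?thesis using null[of n] s(1)[of n] hausdorff_measure_eq_0_mono less_imp_le by blast
    qed
    moreover have "G \<noteq> {}" using AG ne by blast
    ultimately have "hausdorff_dim G \<le> ereal d"
      using d(1) by (simp add: hausdorff_dim_le_ereal_iff)
    then have "hausdorff_dim G = hausdorff_dim A"
      using real hausdorff_dim_mono[OF AG] by simp
    then show thesis using that gd AG by blast
  next
    case MInf
    then show thesis using hausdorff_dim_ge[of A] by simp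
  qed
qed

subsection \<open>Zero-dimensional spaces\<close>

text \<open>Each point has a clopen neighbourhood missing \<open>S\<close> or \<open>T\<close>, and
  countably many of these cover \<open>Y\<close>. Made successively disjoint they remain open, so
  the pieces coming from sets that miss \<open>T\<close> and the remaining pieces form two
  complementary open sets.\<close>

lemma zero_dim_clopen_separation:
  assumes dim: "Y dim_le 0" and Lin: "Lindelof_space Y"
    and S: "closedin Y S" and T: "closedin Y T" and ST: "disjnt S T"
  obtains C where "closedin Y C" "openin Y C" "S \<subseteq> C" "disjnt C T"
proof -
  let ?clopen = "\<lambda>U. closedin Y U \<and> openin Y U"
  define \<U> where "\<U> = {U. ?clopen U \<and> (disjnt U S \<or> disjnt U T)}"
  have nb: "\<exists>U. ?clopen U \<and> x \<in> U \<and> U \<subseteq> W" if "openin Y W" "x \<in> W" for W x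
    using dim that unfolding dimension_le_0_neighbourhood_base_of_clopen
    by (subst (asm) open_neighbourhood_base_of) auto
  have "\<exists>U\<in>\<U>. x \<in> U" if "x \<in> topspace Y" for x
  proof (cases "x \<in> S")
    case True
    then have "x \<in> topspace Y - T" using ST that by (auto simp: disjnt_iff)
    then obtain U where "?clopen U" "x \<in> U" "U \<subseteq> topspace Y - T"
      using nb T by (meson closedin_def)
    then show ?thesis unfolding \<U>_def disjnt_def by blast
  next
    case False
    then have "x \<in> topspace Y - S" using that by auto
    then obtain U where "?clopen U" "x \<in> U" "U \<subseteq> topspace Y - S"
      using nb S by (meson closedin_def)
    then show ?thesis unfolding \<U>_def disjnt_def by blast
  qed
  then have U\<U>: "\<Union>\<U> = topspace Y"
    unfolding \<U>_def by (blast dest: openin_subset)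
  have \<U>_open: "openin Y U" if "U \<in> \<U>" for U using that unfolding \<U>_def by blast
  obtain \<V> where \<V>: "countable \<V>" "\<V> \<subseteq> \<U>" "\<Union>\<V> = topspace Y"
    using Lindelof_spaceD[OF Lin \<U>_open U\<U>] by metis
  \<comment> \<open>Inserting the empty set allows an enumeration even when \<open>\<V>\<close> is
    empty.\<close>
  define V where "V = from_nat_into (insert {} \<V>)"
  have ran: "range V = insert {} \<V>"
    unfolding V_def using \<V>(1) by (intro range_from_nat_into) auto
  have "{} \<in> \<U>" unfolding \<U>_def by auto
  then have V: "V n \<in> \<U>" for n using ran \<V>(2) by (metis insert_subset rangeI subsetD)
  have VU: "(\<Union>n. V n) = topspace Y" using ran \<V>(3) by simp
  have D_open: "openin Y (disjointed V n)" for n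
    unfolding disjointed_def using V
    by (intro openin_diff closedin_Union) (auto simp: \<U>_def)
  define C where "C = (\<Union>n\<in>{n. disjnt (V n) T}. disjointed V n)"
  define C' where "C' = (\<Union>n\<in>{n. \<not> disjnt (V n) T}. disjointed V n)"
  have "C \<union> C' = (\<Union>n. disjointed V n)" unfolding C_def C'_def by blast
  then have CC': "C \<union> C' = topspace Y" by (simp add: UN_disjointed_eq VU)
  have uniq: "m = n" if "x \<in> disjointed V m" "x \<in> disjointed V n" for x m n
    using disjoint_family_disjointed[of V] that
    unfolding disjoint_family_on_def by (metis IntI UNIV_I emptyE)
  have "disjnt C C'"
    unfolding C_def C'_def disjnt_iff using uniq by fast
  then have "C = topspace Y - C'" using CC' unfolding disjnt_def by blast
  moreover have op: "openin Y C" "openin Y C'"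
    unfolding C_def C'_def using D_open by auto
  ultimately have "closedin Y C" by (simp add: openin_closedin_eq)
  moreover have "S \<subseteq> C"
  proof
    fix x assume x: "x \<in> S"
    have "x \<notin> C'"
    proof
      assume "x \<in> C'"
      then obtain n where "\<not> disjnt (V n) T" "x \<in> V n"
        unfolding C'_def using disjointed_subset[of V] by blast
      then show False using V[of n] x unfolding \<U>_def disjnt_iff by blast
    qed
    then show "x \<in> C" using CC' x closedin_subset[OF S] by blast
  qed
  moreover have "disjnt C T"
    unfolding C_def disjnt_def using disjointed_subset[of V] by blast
  ultimately show thesis using op that by blast
qed

text \<open>A relatively clopen \<open>C\<close> splits \<open>F\<close> compatibly with
  \<open>S\<close> and \<open>T\<close>. Since \<open>F\<close> is closed,
  \<open>S \<union> C\<close> and \<open>T \<union> (F - C)\<close> are disjoint closed sets of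
  \<open>Y\<close>, and normality applies. The disjoint closures in the conclusion are valid input
  for the next application, so the construction can be iterated.\<close>

lemma normal_zero_dim_closed_extension:
  assumes norm: "normal_space Y" and Lin: "Lindelof_space Y"
    and F: "closedin Y F" "subtopology Y F dim_le 0"
    and ST: "closedin Y S" "closedin Y T" "disjnt S T"
  obtains U V where "openin Y U" "openin Y V" "S \<subseteq> U" "T \<subseteq> V" "F \<subseteq> U \<union> V"
    "disjnt (Y closure_of U) (Y closure_of V)"
proof -
  have "Lindelof_space (subtopology Y F)"
    using Lindelof_space_closedin_subtopology[OF Lin F(1)] .
  moreover have "closedin (subtopology Y F) (F \<inter> S)" "closedin (subtopology Y F) (F \<inter> T)"
    using ST by (auto simp: closedin_subtopology)
  moreover have "disjnt (F \<inter> S) (F \<inter> T)" using ST(3) by (auto simp: disjnt_iff)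
  ultimately obtain C where C: "closedin (subtopology Y F) C" "openin (subtopology Y F) C"
      "F \<inter> S \<subseteq> C" "disjnt C (F \<inter> T)"
    using zero_dim_clopen_separation[OF F(2)] by metis
  have "closedin (subtopology Y F) (F - C)"
    using C(2) F(1) by (metis closedin_diff closedin_topspace topspace_subtopology_subset closedin_subset)
  then have cl: "closedin Y (F - C)" "closedin Y C"
    using C(1) F(1) closedin_trans_full by blast+
  have CF: "C \<subseteq> F" using C(1) closedin_subset by fastforce
  have "disjnt (S \<union> C) (T \<union> (F - C))"
    using ST(3) C(3,4) CF by (auto simp: disjnt_iff)
  then obtain U V where "openin Y U" "openin Y V" "S \<union> C \<subseteq> U" "T \<union> (F - C) \<subseteq> V"
      "disjnt (Y closure_of U) (Y closure_of V)"
    using norm cl ST unfolding normal_space_disjoint_closures by (metis closedin_Un)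
  then show thesis using that CF by blast
qed

text \<open>Disjoint closed sets are enlarged to open sets in stages, the \<open>n\<close>-th stage
  absorbing \<open>F n\<close>. In the limit two disjoint open sets cover the space, hence are
  clopen. Regularity then turns this separation into a base of clopen neighbourhoods.\<close>

lemma zero_dim_countable_closed_sum:
  fixes F :: "nat \<Rightarrow> 'a set"
  assumes reg: "regular_space Y" and Lin: "Lindelof_space Y"
    and clo: "\<And>n. closedin Y (F n)" and dim: "\<And>n. subtopology Y (F n) dim_le 0"
    and UF: "(\<Union>n. F n) = topspace Y"
  shows "Y dim_le 0"
proof -
  have norm: "normal_space Y" using regular_Lindelof_imp_normal_space[OF reg Lin] .
  have sep: "\<exists>C. closedin Y C \<and> openin Y C \<and> S \<subseteq> C \<and> disjnt C T"
    if ST: "closedin Y S" "closedin Y T" "disjnt S T" for S T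
  proof -
    \<comment> \<open>Set-up for dependent choice: \<open>P\<close> is the invariant of a stage,
      \<open>Q\<close> relates a stage to its successor.\<close>
    define P where "P = (\<lambda>(n::nat) p. case p of (U,V) \<Rightarrow> openin Y U \<and> openin Y V \<and>
        disjnt (Y closure_of U) (Y closure_of V) \<and> S \<subseteq> U \<and> T \<subseteq> V)"
    define Q where "Q = (\<lambda>(n::nat) p q. case (p,q) of ((U,V),(U',V')) \<Rightarrow>
        U \<subseteq> U' \<and> V \<subseteq> V' \<and> F n \<subseteq> U' \<union> V')"
    have "\<exists>p. P 0 p"
      using norm[unfolded normal_space_disjoint_closures, rule_format, of S T] ST
      unfolding P_def by force
    moreover have "\<exists>q. P (Suc n) q \<and> Q n p q" if p: "P n p" for n p
    proof -
      obtain U V where UV: "p = (U,V)" "openin Y U" "openin Y V"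
        "disjnt (Y closure_of U) (Y closure_of V)" "S \<subseteq> U" "T \<subseteq> V"
        using p unfolding P_def by auto
      obtain U' V' where "openin Y U'" "openin Y V'" "Y closure_of U \<subseteq> U'" "Y closure_of V \<subseteq> V'"
        "F n \<subseteq> U' \<union> V'" "disjnt (Y closure_of U') (Y closure_of V')"
        using normal_zero_dim_closed_extension[OF norm Lin clo dim _ _ UV(4)]
        by (metis closedin_closure_of)
      moreover have "U \<subseteq> Y closure_of U" "V \<subseteq> Y closure_of V"
        using UV(2,3) by (simp_all add: closure_of_subset openin_subset)
      ultimately have "P (Suc n) (U',V') \<and> Q n p (U',V')"
        using UV unfolding P_def Q_def by simp blast
      then show ?thesis by blast
    qed
    ultimately have "\<exists>f. \<forall>n. P n (f n) \<and> Q n (f n) (f (Suc n))"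
      by (rule dependent_nat_choice)
    then obtain f where f: "\<And>n. P n (f n)" "\<And>n. Q n (f n) (f (Suc n))"
      by metis
    define U where "U n = fst (f n)" for n
    define V where "V n = snd (f n)" for n
    have UV: "openin Y (U n)" "openin Y (V n)" "disjnt (Y closure_of (U n)) (Y closure_of (V n))"
        "S \<subseteq> U n" "T \<subseteq> V n" "U n \<subseteq> U (Suc n)" "V n \<subseteq> V (Suc n)"
        "F n \<subseteq> U (Suc n) \<union> V (Suc n)" for n
      using f[of n] unfolding P_def Q_def U_def V_def by (auto simp: case_prod_unfold)
    have mono: "incseq U" "incseq V" by (rule incseq_SucI, rule UV)+
    \<comment> \<open>Disjointness is known only within a stage; monotonicity moves both sets to the
      later of the two stages.\<close>
    have disj: "disjnt (U m) (V n)" for m n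
    proof -
      let ?k = "max m n"
      have "U m \<subseteq> U ?k" "V n \<subseteq> V ?k" using mono by (simp_all add: incseqD)
      moreover have "U ?k \<subseteq> Y closure_of U ?k" "V ?k \<subseteq> Y closure_of V ?k"
        using UV(1,2) by (simp_all add: closure_of_subset openin_subset)
      ultimately show ?thesis using UV(3)[of ?k] unfolding disjnt_def by blast
    qed
    let ?C = "\<Union>n. U n" and ?D = "\<Union>n. V n"
    have op: "openin Y ?C" "openin Y ?D" using UV by auto
    have cover: "topspace Y \<subseteq> ?C \<union> ?D"
    proof
      fix x assume "x \<in> topspace Y"
      then obtain n where "x \<in> F n" using UF by auto
      then show "x \<in> ?C \<union> ?D" using UV(8)[of n] by auto
    qed
    have dd: "disjnt ?C ?D" using disj unfolding disjnt_iff by auto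
    have "A = Z - B" if "A \<subseteq> Z" "Z \<subseteq> A \<union> B" "disjnt A B" for A B Z :: "'a set"
      using that unfolding disjnt_def by blast
    then have "?C = topspace Y - ?D"
      using openin_subset[OF op(1)] cover dd .
    then have "closedin Y ?C" using op(2) by (simp add: openin_closedin_eq)
    moreover have "U 0 \<subseteq> ?C" "V 0 \<subseteq> ?D" by auto
    then have "S \<subseteq> ?C" "T \<subseteq> ?D" using UV(4,5)[of 0] by (meson subset_trans)+
    moreover from this(2) have "disjnt ?C T" using dd by (rule disjnt_subset2[rotated])
    ultimately show ?thesis using op by blast
  qed
  have "\<exists>U. (closedin Y U \<and> openin Y U) \<and> x \<in> U \<and> U \<subseteq> W" if W: "openin Y W" "x \<in> W" for W x
  proof -
    obtain U V where V: "openin Y U" "closedin Y V" "x \<in> U" "U \<subseteq> V" "V \<subseteq> W"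
      using reg W unfolding neighbourhood_base_of_closedin[symmetric] neighbourhood_base_of by meson
    have "closedin Y (topspace Y - W)" "disjnt V (topspace Y - W)"
      using W(1) V(5) by (auto simp: disjnt_iff)
    then obtain C where C: "closedin Y C" "openin Y C" "V \<subseteq> C" "disjnt C (topspace Y - W)"
      using sep V(2) by meson
    then have "C \<subseteq> W" using openin_subset[OF C(2)] by (auto simp: disjnt_iff)
    moreover have "x \<in> C" using V(3,4) C(3) by auto
    ultimately show ?thesis using C(1,2) by metis
  qed
  then show ?thesis
    unfolding dimension_le_0_neighbourhood_base_of_clopen
    by (subst open_neighbourhood_base_of) auto
qed

text \<open>Each \<open>F\<^sub>\<sigma>\<close> set splits into countably many closed sets,
  zero-dimensional as subspaces of \<open>F n\<close>; the double sequence is then re-indexed as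
  one.\<close>

lemma zero_dim_countable_fsigma_sum:
  fixes F :: "nat \<Rightarrow> 'a set"
  assumes reg: "regular_space Y" and Lin: "Lindelof_space Y"
    and F: "\<And>n. fsigma_in Y (F n)" and dim: "\<And>n. subtopology Y (F n) dim_le 0"
    and UF: "(\<Union>n. F n) = topspace Y"
  shows "Y dim_le 0"
proof -
  have "\<exists>C. (\<forall>k::nat. closedin Y (C k)) \<and> \<Union>(range C) = F n" for n
    using F[of n] unfolding fsigma_in_ascending by blast
  then obtain C where C: "\<And>n k. closedin Y (C n (k::nat))" "\<And>n. (\<Union>k. C n k) = F n"
    by metis
  define K where "K i = (case prod_decode i of (n,k) \<Rightarrow> C n k)" for i
  show ?thesis
  proof (rule zero_dim_countable_closed_sum[OF reg Lin, of K])
    show "closedin Y (K i)" for i unfolding K_def using C by (simp split: prod.split)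
    show "subtopology Y (K i) dim_le 0" for i
    proof -
      obtain n k where "prod_decode i = (n,k)" by fastforce
      then have "K i \<subseteq> F n" using C(2) by (auto simp: K_def)
      then show ?thesis by (rule dimension_le_subtopologies[OF dim])
    qed
    have "x \<in> (\<Union>i. K i)" if x: "x \<in> F n" for x n
    proof -
      obtain k where "x \<in> C n k" using C(2)[of n] x by blast
      then have "x \<in> K (prod_encode (n,k))" by (simp add: K_def)
      then show ?thesis by blast
    qed
    moreover have "K i \<subseteq> topspace Y" for i
      using C(1) by (auto simp: K_def closedin_subset split: prod.split)
    ultimately show "(\<Union>i. K i) = topspace Y" unfolding UF[symmetric] by fast
  qed
qed

section \<open>Frontiers avoiding a zero-dimensional subset, and countable bases\<close>

text \<open>A relatively clopen splitting of \<open>M\<close> near \<open>x\<close> is extended to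
  disjoint open sets of \<open>Y\<close>. The two halves are in general not closed in
  \<open>Y\<close>, so normality would not suffice; metrizability supplies disjoint open
  neighbourhoods of separated sets.\<close>

lemma zero_dim_subset_frontier_disjnt:
  assumes met: "metrizable_space Y" and sub: "M \<subseteq> topspace Y"
    and dim: "subtopology Y M dim_le 0" and Lin: "Lindelof_space (subtopology Y M)"
    and W: "openin Y W" "x \<in> W"
  obtains U where "openin Y U" "x \<in> U" "U \<subseteq> W" "disjnt (Y frontier_of U) M"
proof -
  have nb: "\<exists>U V. openin Y U \<and> closedin Y V \<and> x \<in> U \<and> U \<subseteq> V \<and> V \<subseteq> W"
    if "openin Y W" "x \<in> W" for W
    using metrizable_imp_regular_space[OF met] that
    unfolding neighbourhood_base_of_closedin[symmetric] neighbourhood_base_of by meson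
  \<comment> \<open>Two nested layers around \<open>x\<close> are chosen. As \<open>C\<close> will
    contain \<open>M \<inter> V1\<close>, the rest of \<open>M\<close> stays separated from
    \<open>U1\<close>; as \<open>C\<close> will lie in \<open>U2\<close>, it stays separated from
    the complement of \<open>V2\<close>.\<close>
  obtain U2 V2 where 2: "openin Y U2" "closedin Y V2" "x \<in> U2" "U2 \<subseteq> V2" "V2 \<subseteq> W"
    using nb[OF W] by blast
  obtain U1 V1 where 1: "openin Y U1" "closedin Y V1" "x \<in> U1" "U1 \<subseteq> V1" "V1 \<subseteq> U2"
    using nb[OF 2(1,3)] by blast
  have sV: "V2 \<subseteq> topspace Y" "V1 \<subseteq> topspace Y" using 1 2 closedin_subset by blast+
  have "closedin (subtopology Y M) (M \<inter> V1)" "closedin (subtopology Y M) (M \<inter> (topspace Y - U2))"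
    using 1(2) 2(1) by (auto intro!: closedin_subtopology_Int_closed)
  moreover have "disjnt (M \<inter> V1) (M \<inter> (topspace Y - U2))" using 1(5) by (auto simp: disjnt_iff)
  ultimately obtain C where C: "closedin (subtopology Y M) C" "openin (subtopology Y M) C"
      "M \<inter> V1 \<subseteq> C" "disjnt C (M \<inter> (topspace Y - U2))"
    using zero_dim_clopen_separation[OF dim Lin] by metis
  have CM: "C \<subseteq> M" using C(1) closedin_subset by fastforce
  have "separatedin (subtopology Y M) C (M - C)"
    using CM C(1,2) sub separatedin_full[of C "M - C" "subtopology Y M"]
    by (metis Diff_partition Diff_disjoint closedin_def disjnt_def openin_closedin_eq topspace_subtopology_subset)
  then have s1: "separatedin Y C (M - C)" by (simp add: separatedin_subtopology)
  have CU2: "C \<subseteq> U2" using C(4) CM sub by (auto simp: disjnt_iff)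
  have s2: "separatedin Y U1 (topspace Y - V2)"
    using 1 2 by (subst separatedin_open_sets) (auto simp: disjnt_iff)
  have "separatedin Y U2 (topspace Y - V2)"
    using 2 by (subst separatedin_open_sets) (auto simp: disjnt_iff)
  then have s3: "separatedin Y C (topspace Y - V2)"
    using CU2 by (rule separatedin_mono) simp
  have s4: "separatedin Y U1 (M - C)"
  proof (rule separatedin_mono)
    show "separatedin Y U1 (topspace Y - V1)"
      using 1 by (subst separatedin_open_sets) (auto simp: disjnt_iff)
    show "M - C \<subseteq> topspace Y - V1" using C(3) sub by blast
  qed simp
  \<comment> \<open>Disjoint open sets around \<open>?K1\<close> and \<open>?K2\<close> cover \<open>M\<close>, so neither has boundary points in \<open>M\<close>.\<close>
  let ?K1 = "C \<union> U1" and ?K2 = "(M - C) \<union> (topspace Y - V2)"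
  have "separatedin Y ?K1 ?K2" using s1 s2 s3 s4 by simp
  then obtain U V where UV: "openin Y U" "openin Y V" "?K1 \<subseteq> U" "?K2 \<subseteq> V" "disjnt U V"
    using metrizable_space_separation[OF met] by metis
  show thesis
  proof
    show "openin Y U" "x \<in> U" using UV 1 by auto
    show "U \<subseteq> W" using UV 2 openin_subset[OF UV(1)] unfolding disjnt_def by blast
    have "V \<inter> Y closure_of U = {}"
      using UV by (subst openin_Int_closure_of_eq_empty) (auto simp: disjnt_iff)
    then have "Y frontier_of U \<inter> (U \<union> V) = {}"
      using UV(1) by (auto simp: frontier_of_openin)
    moreover have "M \<subseteq> U \<union> V" using UV by blast
    ultimately show "disjnt (Y frontier_of U) M" unfolding disjnt_def by blast
  qed
qed

text \<open>An open set and its closure differ only by the frontier, so each base member has a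
  clopen trace on the remaining set.\<close>

lemma zero_dim_Diff_frontiers:
  assumes B: "is_base Y \<B>"
  shows "subtopology Y (topspace Y - (\<Union>U\<in>\<B>. Y frontier_of U)) dim_le 0"
    (is "subtopology Y ?M dim_le 0")
proof -
  have "\<exists>U. (closedin (subtopology Y ?M) U \<and> openin (subtopology Y ?M) U) \<and> x \<in> U \<and> U \<subseteq> W"
    if W: "openin (subtopology Y ?M) W" and x: "x \<in> W" for W x
  proof -
    obtain V where V: "openin Y V" "W = V \<inter> ?M" using W by (auto simp: openin_subtopology)
    then obtain U where U: "U \<in> \<B>" "x \<in> U" "U \<subseteq> V" "openin Y U"
      using B x unfolding is_base_def by blast
    have "U \<inter> ?M = Y closure_of U \<inter> ?M"
      using U closure_of_subset[OF openin_subset[OF U(4)]] by (auto simp: frontier_of_openin)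
    then have "closedin (subtopology Y ?M) (U \<inter> ?M)"
      by (metis closedin_closure_of closedin_subtopology)
    moreover have "openin (subtopology Y ?M) (U \<inter> ?M)"
      using U(4) by (auto simp: openin_subtopology)
    ultimately show ?thesis using U V x by blast
  qed
  then show ?thesis
    unfolding dimension_le_0_neighbourhood_base_of_clopen
    by (subst open_neighbourhood_base_of) auto
qed

text \<open>For each pair \<open>(V,W)\<close> from a countable base that admits a member of
  \<open>\<B>\<close> in between, one such member is chosen. Squeezing
  \<open>V \<subseteq> U \<subseteq> W\<close> around a point shows that these choices form a
  base.\<close>

lemma countable_subbase:
  assumes sc: "second_countable Y" and B: "is_base Y \<B>"
  obtains \<C> where "\<C> \<subseteq> \<B>" "countable \<C>" "is_base Y \<C>"
proof -
  obtain \<D> where D: "countable \<D>" "\<And>V. V \<in> \<D> \<Longrightarrow> openin Y V"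
    "\<And>U x. openin Y U \<Longrightarrow> x \<in> U \<Longrightarrow> \<exists>V\<in>\<D>. x \<in> V \<and> V \<subseteq> U"
    using sc unfolding second_countable_def by metis
  define I where "I = {(V,W) \<in> \<D> \<times> \<D>. \<exists>U\<in>\<B>. V \<subseteq> U \<and> U \<subseteq> W}"
  have "\<forall>p\<in>I. \<exists>U. U \<in> \<B> \<and> fst p \<subseteq> U \<and> U \<subseteq> snd p" unfolding I_def by auto
  then obtain g where g: "\<And>p. p \<in> I \<Longrightarrow> g p \<in> \<B> \<and> fst p \<subseteq> g p \<and> g p \<subseteq> snd p" by metis
  show thesis
  proof
    show sub: "g ` I \<subseteq> \<B>" using g by auto
    have "I \<subseteq> \<D> \<times> \<D>" unfolding I_def by blast
    then have "countable I" using D(1) by (meson countable_SIGMA countable_subset)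
    then show "countable (g ` I)" by simp
    show "is_base Y (g ` I)"
      unfolding is_base_def
    proof (intro conjI allI impI)
      show "\<forall>U\<in>g ` I. openin Y U" using sub B unfolding is_base_def by blast
      fix O' x assume "openin Y O' \<and> x \<in> O'"
      then obtain W where W: "W \<in> \<D>" "x \<in> W" "W \<subseteq> O'" using D by blast
      then obtain U where U: "U \<in> \<B>" "x \<in> U" "U \<subseteq> W" "openin Y U"
        using B D(2) unfolding is_base_def by meson
      then obtain V where V: "V \<in> \<D>" "x \<in> V" "V \<subseteq> U" using D by blast
      then have "(V,W) \<in> I" using U W unfolding I_def by blast
      then have "g (V,W) \<in> g ` I" "V \<subseteq> g (V,W)" "g (V,W) \<subseteq> W"
        using g[of "(V,W)"] by auto
      then show "\<exists>U\<in>g ` I. x \<in> U \<and> U \<subseteq> O'" using V W by blast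
    qed
  qed
qed

lemma separable_imp_second_countable:
  fixes X :: "'a::metric_space set"
  assumes "separable_space (top_of_set X)"
  shows "second_countable (top_of_set X)"
proof -
  obtain D where D: "countable D" "D \<subseteq> X" "top_of_set X closure_of D = X"
    using assms unfolding separable_space_def by auto
  define \<B> where "\<B> = (\<lambda>(c,q). X \<inter> ball c (1 / real (Suc q))) ` (D \<times> (UNIV::nat set))"
  show ?thesis
    unfolding second_countable_def
  proof (intro exI conjI allI impI)
    show "countable \<B>" unfolding \<B>_def using D(1) by simp
    show "\<forall>V\<in>\<B>. openin (top_of_set X) V" unfolding \<B>_def by auto
    fix U x assume "openin (top_of_set X) U \<and> x \<in> U"
    then obtain O' where O': "open O'" "U = X \<inter> O'" "x \<in> X" "x \<in> O'" by (auto simp: openin_open)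
    then obtain e where e: "e > 0" "ball x e \<subseteq> O'" by (meson open_contains_ball)
    \<comment> \<open>With a radius below \<open>e / 2\<close>, a ball about a dense point close to
      \<open>x\<close> contains \<open>x\<close> and stays within \<open>e\<close> of it.\<close>
    obtain q where q: "1 / real (Suc q) < e / 2" using e by (meson half_gt_zero nat_approx_posE)
    have "openin (top_of_set X) (X \<inter> ball x (1 / real (Suc q)))" by auto
    moreover have "x \<in> top_of_set X closure_of D" using D(3) O'(3) by simp
    moreover have "x \<in> X \<inter> ball x (1 / real (Suc q))" using O'(3) by simp
    ultimately obtain c where "c \<in> D" "c \<in> X \<inter> ball x (1 / real (Suc q))"
      unfolding in_closure_of by blast
    then have c: "c \<in> D" "dist x c < 1 / real (Suc q)" by auto
    have "ball c (1 / real (Suc q)) \<subseteq> ball x e"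
    proof
      fix y assume "y \<in> ball c (1 / real (Suc q))"
      then show "y \<in> ball x e" using c q dist_triangle[of x y c] by simp
    qed
    then have "x \<in> X \<inter> ball c (1 / real (Suc q))" "X \<inter> ball c (1 / real (Suc q)) \<subseteq> U"
      using O' e c by (auto simp: dist_commute)
    moreover have "X \<inter> ball c (1 / real (Suc q)) \<in> \<B>" unfolding \<B>_def using c by force
    ultimately show "\<exists>V\<in>\<B>. x \<in> V \<and> V \<subseteq> U" by blast
  qed
qed

subsection \<open>Topological Hausdorff dimension\<close>

theorem theorem3p6:
  fixes X :: "'a::metric_space set"
  assumes "X \<noteq> {}" and "separable_space (top_of_set X)"
  shows "let S = {d::ereal. \<exists>A\<subseteq>X. hausdorff_dim A \<le> d - 1 \<and>
                                  small_ind_dim (top_of_set (X - A)) \<le> 0}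
         in top_hausdorff_dim X \<in> S \<and> (\<forall>d\<in>S. top_hausdorff_dim X \<le> d)"
proof -
  let ?T = "top_of_set X"
  let ?S = "{d::ereal. \<exists>A\<subseteq>X. hausdorff_dim A \<le> d - 1 \<and> small_ind_dim (top_of_set (X - A)) \<le> 0}"
  define t where "t = top_hausdorff_dim X"
  have sc: "second_countable ?T" using assms(2) by (rule separable_imp_second_countable)
  have sc_sub: "second_countable (top_of_set M)" if "M \<subseteq> X" for M
    using second_countable_subtopology[OF sc, of M] that
    by (simp add: subtopology_subtopology Int_absorb1)
  have met: "metrizable_space (top_of_set M)" for M :: "'a set"
    by (simp add: metrizable_space_subtopology metrizable_space_euclidean)
  have sub: "subtopology ?T M = top_of_set M" if "M \<subseteq> X" for M
    using that by (simp add: subtopology_subtopology Int_absorb1)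
  have zero: "small_ind_dim Y \<le> 0 \<longleftrightarrow> Y dim_le 0" for Y :: "'a topology"
    using small_ind_dim_le_real_iff[of Y 0] by (simp add: zero_ereal_def)
  have t_eq: "t = Inf {d. \<exists>\<B>. is_base ?T \<B> \<and> (\<forall>U\<in>\<B>. hausdorff_dim (?T frontier_of U) \<le> d - 1)}"
    using assms(1) by (simp add: t_def top_hausdorff_dim_def)
  have upper: "t \<le> d" if d: "d \<in> ?S" for d
  proof -
    obtain A where A: "A \<subseteq> X" "hausdorff_dim A \<le> d - 1" "top_of_set (X - A) dim_le 0"
      using d zero by blast
    let ?M = "X - A"
    define \<B> where "\<B> = {U. openin ?T U \<and> disjnt (?T frontier_of U) ?M}"
    have "is_base ?T \<B>"
      unfolding is_base_def
    proof (intro conjI allI impI)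
      show "\<forall>U\<in>\<B>. openin ?T U" by (simp add: \<B>_def)
      fix V x assume V: "openin ?T V \<and> x \<in> V"
      have sM: "subtopology ?T ?M = top_of_set ?M" by (rule sub) simp
      obtain U where "openin ?T U" "x \<in> U" "U \<subseteq> V" "disjnt (?T frontier_of U) ?M"
      proof (rule zero_dim_subset_frontier_disjnt[OF met, of ?M X V x])
        show "subtopology ?T ?M dim_le 0" using A(3) sM by simp
        show "Lindelof_space (subtopology ?T ?M)"
          unfolding sM by (intro second_countable_imp_Lindelof_space sc_sub) simp
      qed (use V in auto)
      then show "\<exists>U\<in>\<B>. x \<in> U \<and> U \<subseteq> V" unfolding \<B>_def by blast
    qed
    moreover have "hausdorff_dim (?T frontier_of U) \<le> d - 1" if "U \<in> \<B>" for U
    proof -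
      have "?T frontier_of U \<subseteq> X" using frontier_of_subset_topspace[of ?T U] by simp
      then have "?T frontier_of U \<subseteq> A" using that unfolding \<B>_def disjnt_def by blast
      then show ?thesis using A(2) hausdorff_dim_mono order_trans by blast
    qed
    ultimately show ?thesis unfolding t_eq by (intro Inf_lower) blast
  qed
  have base_imp: "\<exists>A. A \<subseteq> X \<and> hausdorff_dim A \<le> d - 1 \<and> top_of_set (X - A) dim_le 0"
    if base: "is_base ?T \<B>" and le: "\<forall>U\<in>\<B>. hausdorff_dim (?T frontier_of U) \<le> d - 1" for d \<B>
  proof -
    obtain \<C> where C: "\<C> \<subseteq> \<B>" "countable \<C>" "is_base ?T \<C>"
      using countable_subbase[OF sc base] by metis
    let ?A = "\<Union>U\<in>\<C>. ?T frontier_of U"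
    have AX: "?A \<subseteq> X" using frontier_of_subset_topspace[of ?T] by fastforce
    \<comment> \<open>A base of a nonempty space has a member, and its frontier has dimension at
      least -1. This gives the lower bound on \<open>d - 1\<close> that covers the case of an empty
      union.\<close>
    obtain U where "U \<in> \<B>" using base assms(1) unfolding is_base_def
      by (metis ex_in_conv openin_topspace topspace_euclidean_subtopology)
    then have "-1 \<le> d - 1" using le hausdorff_dim_ge order_trans by blast
    then have "hausdorff_dim ?A \<le> d - 1" using C le by (intro hausdorff_dim_UN_le) auto
    moreover have "top_of_set (X - ?A) dim_le 0"
      using zero_dim_Diff_frontiers[OF C(3)] sub[of "X - ?A"] by simp
    ultimately show ?thesis using AX by blast
  qed
  have t_approx: "\<exists>A. A \<subseteq> X \<and> hausdorff_dim A \<le> d - 1 \<and> top_of_set (X - A) dim_le 0"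
    if td: "t < d" for d
  proof -
    obtain d' \<B> where "d' < d" and B: "is_base ?T \<B>"
        "\<forall>U\<in>\<B>. hausdorff_dim (?T frontier_of U) \<le> d' - 1"
      using td unfolding t_eq Inf_less_iff by blast
    then have "d' - 1 \<le> d - 1" by (intro ereal_minus_mono) auto
    then show ?thesis using base_imp[OF B] order_trans by blast
  qed
  \<comment> \<open>This excludes the value minus infinity in the case split below: a negative
    \<open>d\<close> above \<open>t\<close> would yield a set of dimension less than -1.\<close>
  have t_nonneg: "0 \<le> t"
  proof (rule ccontr)
    assume "\<not> 0 \<le> t"
    then have "t < 0" by simp
    then obtain d where d: "t < d" "d < 0" using dense[of t 0] by metis
    obtain A :: "'a set" where "hausdorff_dim A \<le> d - 1" using t_approx[OF d(1)] by blast
    then have "-1 \<le> d - 1" by (rule order_trans[OF hausdorff_dim_ge])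
    then show False using d(2) by (cases d) (auto simp: one_ereal_def)
  qed
  have "t \<in> ?S"
  proof (cases t)
    case PInf
    \<comment> \<open>The witness is \<open>X\<close> itself: its dimension bound is infinite, and
      the complement is empty.\<close>
    have "top_of_set (X - X) dim_le 0" using dimension_le_mono[of "top_of_set {}" "-1" 0] by simp
    then show ?thesis using PInf zero by auto
  next
    case (real u)
    have "\<exists>A. A \<subseteq> X \<and> hausdorff_dim A \<le> ereal (u + 1 / real (Suc n)) - 1 \<and>
        top_of_set (X - A) dim_le 0" for n
      by (rule t_approx) (simp add: real)
    then obtain A where A: "\<And>n. A n \<subseteq> X" "\<And>n. top_of_set (X - A n) dim_le 0"
        "\<And>n. hausdorff_dim (A n) \<le> ereal (u + 1 / real (Suc n)) - 1"
      by metis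
    have "\<exists>G. gdelta_in euclidean G \<and> A n \<subseteq> G \<and> hausdorff_dim G = hausdorff_dim (A n)" for n
      using hausdorff_dim_gdelta_hull by metis
    then obtain G where G: "\<And>n. gdelta_in euclidean (G n)" "\<And>n. A n \<subseteq> G n"
        "\<And>n. hausdorff_dim (G n) = hausdorff_dim (A n)"
      by metis
    \<comment> \<open>The hulls \<open>G n\<close> are taken in the ambient type and may leave
      \<open>X\<close>, hence the intersection with \<open>X\<close>.\<close>
    define H where "H = X \<inter> (\<Inter>n. G n)"
    have "hausdorff_dim H \<le> t - 1"
    proof (rule ereal_le_epsilon2)
      fix e :: real assume "0 < e"
      then obtain n where n: "1 / real (Suc n) < e" by (meson nat_approx_posE)
      have "hausdorff_dim H \<le> hausdorff_dim (G n)"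
        by (rule hausdorff_dim_mono) (auto simp: H_def)
      also have "\<dots> \<le> ereal (u + 1 / real (Suc n)) - 1" using A(3) G(3) by simp
      also have "\<dots> \<le> t - 1 + ereal e" using n real by (simp add: one_ereal_def)
      finally show "hausdorff_dim H \<le> t - 1 + ereal e" .
    qed
    moreover have "top_of_set (X - H) dim_le 0"
    proof (rule zero_dim_countable_fsigma_sum)
      show "regular_space (top_of_set (X - H))" by (intro metrizable_imp_regular_space met)
      show "Lindelof_space (top_of_set (X - H))"
        by (intro second_countable_imp_Lindelof_space sc_sub) simp
      show "fsigma_in (top_of_set (X - H)) (X - G n)" for n
      proof -
        \<comment> \<open>The complement is \<open>F\<^sub>\<sigma>\<close> in the ambient space,
          and its trace on \<open>X - H\<close> is all of \<open>X - G n\<close> because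
          \<open>H\<close> lies in \<open>G n\<close>.\<close>
        have "fsigma_in euclidean (UNIV - G n)"
          using G(1)[of n] by (simp add: gdelta_in_fsigma_in)
        moreover have "X - G n = (UNIV - G n) \<inter> (X - H)" by (auto simp: H_def)
        ultimately show ?thesis unfolding fsigma_in_subtopology by blast
      qed
      show "subtopology (top_of_set (X - H)) (X - G n) dim_le 0" for n
      proof -
        have "X - G n \<subseteq> X - A n" "(X - H) \<inter> (X - G n) = X - G n"
          using G(2) by (auto simp: H_def)
        then show ?thesis
          using dimension_le_subtopologies[OF A(2)[of n]] by (simp add: subtopology_subtopology)
      qed
      show "(\<Union>n. X - G n) = topspace (top_of_set (X - H))" by (auto simp: H_def)
    qed
    ultimately show ?thesis using zero by (auto simp: H_def)
  qed (use t_nonneg in auto)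
  then show ?thesis using upper unfolding Let_def t_def by blast
qed

end
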